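(* Let $\mathbb{A}$ and $\mathbb{B}$ be two tensors of order $m\ge 3$ and dimension $n$. Suppose that $\mathbb{A}$ and $\mathbb{B}$ are similar and that $\mathbb{A}$ is a diagonal tensor. Then $\mathbb{B}$ is a diagonal tensor.
   Context: Write $[n]=\{1,\ldots,n\}$. An order $m$ dimension $n$ tensor $\mathbb{A}=(a_{i_1i_2\ldots i_m})$ is a multidimensional array of complex numbers $a_{i_1\ldots i_m}$ indexed by $i_1,\ldots,i_m\in[n]$. The unit tensor of order $m$ and dimension $n$ is $\mathbb{I}=(\delta_{i_1\ldots i_m})$ with $\delta_{i_1\ldots i_m}=1$ if $i_1=\cdots=i_m$ and $0$ otherwise. For complex matrices $P=(p_{ij}),Q=(q_{ij})$ of order $n$ and a tensor $\mathbb{A}$ of order $m$ and dimension $n$, the product $P\mathbb{A}Q$ is the order $m$ dimension $n$ tensor with entries $$(P\mathbb{A}Q)_{i_1\ldots i_m}=\sum_{j_1,\ldots,j_m=1}^n p_{i_1j_1}a_{j_1j_2\ldots j_m}q_{j_2i_2}\cdots q_{j_mi_m}.$$ Two order $m$ dimension $n$ tensors $\mathbb{A},\mathbb{B}$ are similar if there exist matrices $P,Q$ of order $n$ with $P\mathbb{I}Q=\mathbb{I}$ and $\mathbb{B}=P\mathbb{A}Q$. A tensor $\mathbb{A}=(a_{i_1\ldots i_m})$ is diagonal if $a_{i_1i_2\ldots i_m}=0$ whenever $(i_1,i_2,\ldots,i_m)\neq(i_1,i_1,\ldots,i_1)$. *)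

theory Defs
  imports "HOL-Analysis.Analysis"
begin

text \<open>The index set \<open>[n]\<close> is a finite type \<open>'n\<close> with \<open>CARD('n) = n\<close>, so that matrices of order
  \<open>n\<close> are those of HOL-Analysis. A multi-index \<open>(i\<^sub>1, \<dots>, i\<^sub>m)\<close> is a list of length \<open>m\<close>;
  its entries are counted from 0, so \<open>i\<^sub>k\<close> is \<open>ix ! (k - 1)\<close>.\<close>

definition multi_indices :: "nat \<Rightarrow> 'n list set" where
  "multi_indices m = {ix. length ix = m}"

text \<open>Tensors are extensional on the multi-indices, so HOL equality of two tensors of order \<open>m\<close>
  is entrywise equality.\<close>

definition tensors :: "nat \<Rightarrow> ('n::finite list \<Rightarrow> complex) set" where
  "tensors m = multi_indices m \<rightarrow>\<^sub>E UNIV"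

definition unit_tensor :: "nat \<Rightarrow> 'n::finite list \<Rightarrow> complex" where
  "unit_tensor m =
    (\<lambda>ix\<in>multi_indices m. if \<forall>k<m. ix ! k = ix ! 0 then 1 else 0)"

definition tensor_prod ::
  "nat \<Rightarrow> complex^'n^'n \<Rightarrow> ('n::finite list \<Rightarrow> complex) \<Rightarrow> complex^'n^'n \<Rightarrow> 'n list \<Rightarrow> complex" where
  "tensor_prod m P A Q =
    (\<lambda>ix\<in>multi_indices m. \<Sum>jx\<in>multi_indices m.
       P $ (ix ! 0) $ (jx ! 0) * A jx * (\<Prod>k=1..<m. Q $ (jx ! k) $ (ix ! k)))"

definition similar_tensors ::
  "nat \<Rightarrow> ('n::finite list \<Rightarrow> complex) \<Rightarrow> ('n list \<Rightarrow> complex) \<Rightarrow> bool" where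
  "similar_tensors m A B \<longleftrightarrow>
    A \<in> tensors m \<and> B \<in> tensors m \<and>
    (\<exists>P Q :: complex^'n^'n.
       tensor_prod m P (unit_tensor m) Q = unit_tensor m \<and> B = tensor_prod m P A Q)"

definition diagonal_tensor :: "nat \<Rightarrow> ('n::finite list \<Rightarrow> complex) \<Rightarrow> bool" where
  "diagonal_tensor m A \<longleftrightarrow>
    (\<forall>ix\<in>multi_indices m. ix \<noteq> replicate m (ix ! 0) \<longrightarrow> A ix = 0)"

end

theory Submission
  imports Defs
begin

text \<open>For a diagonal tensor \<open>D\<close> the sum defining \<open>P D Q\<close> collapses to one index:
  \<open>(P D Q)\<^bsub>i\<^sub>1 \<dots> i\<^sub>m\<^esub> = \<Sum>\<^sub>j d\<^sub>j p\<^bsub>i\<^sub>1 j\<^esub> q\<^bsub>j i\<^sub>2\<^esub> \<dots> q\<^bsub>j i\<^sub>m\<^esub>\<close>.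
  The theorem holds because, off the diagonal, \<^emph>\<open>every\<close> term of this sum vanishes as soon as
  \<open>P \<I> Q = \<I>\<close>, whatever the \<open>d\<^sub>j\<close> are.

  Let \<open>R\<close> be the entrywise power \<open>q\<^bsub>jk\<^esub>\<^bsup>m-1\<^esup>\<close> of \<open>Q\<close>. The entries \<open>(i, k, \<dots>, k)\<close> of
  \<open>P \<I> Q = \<I>\<close> say \<open>P R = 1\<close>, so \<open>P\<close> is invertible. For \<open>a \<noteq> b\<close> the entries
  \<open>(i, b, a, \<dots>, a)\<close>, which exist because \<open>m \<ge> 3\<close>, say that \<open>P\<close> annihilates the vector
  \<open>(q\<^bsub>jb\<^esub> q\<^bsub>ja\<^esub>\<^bsup>m-2\<^esup>)\<^sub>j\<close>. Hence each row of \<open>Q\<close>, and of \<open>R\<close>, has at most one nonzero entry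
  (\<open>unit_preserving_row_support\<close>). An invertible matrix with this property is monomial, and its
  inverse \<open>P\<close> has the transposed zero pattern (\<open>inverse_of_row_sparse\<close>). So a nonzero
  term \<open>p\<^bsub>i\<^sub>1 j\<^esub> q\<^bsub>j i\<^sub>2\<^esub> \<dots> q\<^bsub>j i\<^sub>m\<^esub>\<close> forces \<open>i\<^sub>2 = \<dots> = i\<^sub>m\<close> by the first fact and then
  \<open>i\<^sub>1 = i\<^sub>2\<close> by the second.\<close>

lemma finite_multi_indices: "finite (multi_indices m :: 'n::finite list set)"
  using finite_lists_length_eq[of "UNIV :: 'n set" m] by (simp add: multi_indices_def)

lemma diagonal_unit_tensor: "diagonal_tensor m (unit_tensor m)"
proof -
  have const: "ix = replicate m c" if "length ix = m" "\<forall>k<m. ix ! k = c" for ix :: "'a list" and c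
    using that by (auto simp: list_eq_iff_nth_eq)
  show ?thesis
    unfolding diagonal_tensor_def
  proof (intro ballI impI)
    fix ix :: "'a list"
    assume ix: "ix \<in> multi_indices m" and nd: "ix \<noteq> replicate m (ix ! 0)"
    have "\<not> (\<forall>k<m. ix ! k = ix ! 0)"
    proof
      assume "\<forall>k<m. ix ! k = ix ! 0"
      with ix have "ix = replicate m (ix ! 0)"
        unfolding multi_indices_def by (intro const) (erule CollectD, assumption)
      with nd show False ..
    qed
    then show "unit_tensor m ix = 0"
      unfolding unit_tensor_def by (simp only: restrict_apply' [OF ix] if_False)
  qed
qed

lemma tensor_prod_diagonal:
  fixes A :: "'n::finite list \<Rightarrow> complex"
  assumes "m > 0" "diagonal_tensor m A" "length ix = m"
  shows "tensor_prod m P A Q ix =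
    (\<Sum>j\<in>UNIV. P $ (ix ! 0) $ j * A (replicate m j) * (\<Prod>k=1..<m. Q $ j $ (ix ! k)))"
proof -
  let ?f = "\<lambda>jx. P $ (ix ! 0) $ (jx ! 0) * A jx * (\<Prod>k=1..<m. Q $ (jx ! k) $ (ix ! k))"
  have "tensor_prod m P A Q ix = sum ?f (multi_indices m)"
    using assms by (simp add: tensor_prod_def multi_indices_def)
  also have "\<dots> = sum ?f (range (replicate m))"
  proof (rule sum.mono_neutral_right[OF finite_multi_indices])
    show "range (replicate m) \<subseteq> multi_indices m"
      by (auto simp: multi_indices_def)
    show "\<forall>jx\<in>multi_indices m - range (replicate m). ?f jx = 0"
      using assms(2) by (auto simp: diagonal_tensor_def)
  qed
  also have "\<dots> = (\<Sum>j\<in>UNIV. ?f (replicate m j))"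
    using assms(1) by (subst sum.reindex) (auto simp: inj_on_def)
  also have "\<dots> = (\<Sum>j\<in>UNIV. P $ (ix ! 0) $ j * A (replicate m j) * (\<Prod>k=1..<m. Q $ j $ (ix ! k)))"
    using assms(1) by (intro sum.cong refl arg_cong2[of _ _ _ _ "(*)"] prod.cong) auto
  finally show ?thesis .
qed

text \<open>The condition \<open>P \<I> Q = \<I>\<close> written out, with the first index \<open>i\<close> separated from the
  others: for a fixed list \<open>ks\<close> it is a linear system with matrix \<open>P\<close>.\<close>

lemma unit_preserving_entries:
  fixes P Q :: "complex^'n^'n"
  assumes "tensor_prod m P (unit_tensor m) Q = unit_tensor m" "m > 0" "length ks = m - 1"
  shows "(\<Sum>j\<in>UNIV. P $ i $ j * (\<Prod>k<m - 1. Q $ j $ (ks ! k))) =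
    (if ks = replicate (m - 1) i then 1 else 0)"
proof -
  have len: "length (i # ks) = m"
    using assms by simp
  have one: "unit_tensor m (replicate m j) = 1" for j :: 'n
    by (auto simp: unit_tensor_def multi_indices_def)
  have shift: "(\<Prod>k=1..<m. Q $ j $ (ks ! (k - 1))) = (\<Prod>k<m - 1. Q $ j $ (ks ! k))" for j
    by (rule prod.reindex_bij_witness[of _ Suc "\<lambda>k. k - 1"]) auto
  have "(\<Sum>j\<in>UNIV. P $ i $ j * (\<Prod>k<m - 1. Q $ j $ (ks ! k))) = unit_tensor m (i # ks)"
    using tensor_prod_diagonal[OF assms(2) diagonal_unit_tensor len, of P Q] assms(1)
    by (simp add: one shift[simplified])
  also have "\<dots> = (if ks = replicate (m - 1) i then 1 else 0)"
  proof -
    have "(\<forall>k<m. (i # ks) ! k = i) \<longleftrightarrow> i # ks = replicate m i"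
      using len by (auto simp: list_eq_iff_nth_eq)
    also have "\<dots> \<longleftrightarrow> ks = replicate (m - 1) i"
      using assms(2) by (cases m) auto
    finally show ?thesis
      using len by (simp add: unit_tensor_def multi_indices_def)
  qed
  finally show ?thesis .
qed

lemma unit_preserving_right_inverse:
  fixes P Q :: "complex^'n^'n"
  assumes "tensor_prod m P (unit_tensor m) Q = unit_tensor m" "m \<ge> 2"
  shows "P ** (\<chi> j k. (Q $ j $ k) ^ (m - 1)) = mat 1"
proof -
  have "(\<Sum>j\<in>UNIV. P $ i $ j * (Q $ j $ k) ^ (m - 1)) = (if i = k then 1 else 0)" for i k
    using unit_preserving_entries[OF assms(1), of "replicate (m - 1) k" i] assms(2)
    by auto
  then show ?thesis
    by (simp add: matrix_matrix_mult_def mat_def vec_eq_iff)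
qed

text \<open>The entries \<open>(i, b, a, \<dots>, a)\<close> of \<open>\<I>\<close> vanish for every \<open>i\<close>, so the vector with
  entries \<open>q\<^bsub>jb\<^esub> q\<^bsub>ja\<^esub>\<^bsup>m-2\<^esup>\<close> is in the kernel of the invertible matrix \<open>P\<close>. For \<open>m = 2\<close> this vector
  is just a column of \<open>Q\<close> and the argument breaks down, as \<open>P \<I> Q = \<I>\<close> then only says that
  \<open>P\<close> and \<open>Q\<close> are inverse matrices.\<close>

lemma unit_preserving_row_support:
  fixes P Q :: "complex^'n^'n"
  assumes "tensor_prod m P (unit_tensor m) Q = unit_tensor m" "m \<ge> 3" "a \<noteq> b"
  shows "Q $ j $ a = 0 \<or> Q $ j $ b = 0"
proof -
  let ?ks = "b # replicate (m - 2) a"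
  define v where "v = (\<chi> j. \<Prod>k<m - 1. Q $ j $ (?ks ! k))"
  have len: "length ?ks = m - 1"
    using assms by simp
  have "a \<in> set ?ks" "b \<in> set ?ks"
    using assms by auto
  then have "?ks \<noteq> replicate (m - 1) i" for i
    using assms(3) by (metis in_set_replicate)
  then have "P *v v = 0"
    using unit_preserving_entries[OF assms(1) _ len] assms(2)
    by (simp add: vec_eq_iff matrix_vector_mult_def v_def)
  moreover have "(\<chi> j k. (Q $ j $ k) ^ (m - 1)) ** P = mat 1"
    using unit_preserving_right_inverse[OF assms(1)] assms(2) matrix_left_right_inverse[of P]
    by simp
  ultimately have "v = 0"
    by (metis matrix_vector_mul_assoc matrix_vector_mul_lid matrix_vector_mult_0_right)
  then have "(\<Prod>k<m - 1. Q $ j $ (?ks ! k)) = 0"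
    by (simp add: v_def vec_eq_iff)
  then obtain k where k: "k < m - 1" "Q $ j $ (?ks ! k) = 0"
    by auto
  have "?ks ! k \<in> set ?ks"
    using k len by (metis nth_mem)
  then have "?ks ! k \<in> {a, b}"
    by auto
  then show ?thesis
    using k by auto
qed

text \<open>If the rows of \<open>R\<close> have at most one nonzero entry, the equation \<open>R P = 1\<close> reads
  \<open>r\<^bsub>jk\<^esub> p\<^bsub>kj'\<^esub> = \<delta>\<^bsub>jj'\<^esub>\<close> whenever \<open>r\<^bsub>jk\<^esub> \<noteq> 0\<close>. Hence the columns of \<open>R\<close> also have at most one
  nonzero entry, and so \<open>(P R)\<^bsub>ik\<^esub> = p\<^bsub>ij\<^esub> r\<^bsub>jk\<^esub>\<close>, which is \<open>0\<close> for \<open>i \<noteq> k\<close>.\<close>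

lemma inverse_of_row_sparse:
  fixes P R :: "'a::field^'n^'n"
  assumes inv: "P ** R = mat 1"
    and row: "\<And>j a b. a \<noteq> b \<Longrightarrow> R $ j $ a = 0 \<or> R $ j $ b = 0"
    and nz: "R $ j $ k \<noteq> 0" and "i \<noteq> k"
  shows "P $ i $ j = 0"
proof -
  have inv': "R ** P = mat 1"
    using inv matrix_left_right_inverse by blast
  have rp: "R $ j1 $ k * P $ k $ j2 = (if j1 = j2 then 1 else 0)" if "R $ j1 $ k \<noteq> 0" for j1 j2
  proof -
    have "(\<Sum>l\<in>UNIV. R $ j1 $ l * P $ l $ j2) = (\<Sum>l\<in>{k}. R $ j1 $ l * P $ l $ j2)"
      using row[of _ k j1] that by (intro sum.mono_neutral_right) auto
    moreover have "(R ** P) $ j1 $ j2 = (if j1 = j2 then 1 else 0)"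
      by (simp add: inv' mat_def)
    ultimately show ?thesis
      by (simp add: matrix_matrix_mult_def)
  qed
  have col: "R $ j' $ k = 0" if "j' \<noteq> j" for j'
    using rp[of j j] rp[of j' j] nz that by (cases "P $ k $ j = 0") auto
  have "(\<Sum>l\<in>UNIV. P $ i $ l * R $ l $ k) = (\<Sum>l\<in>{j}. P $ i $ l * R $ l $ k)"
    using col by (intro sum.mono_neutral_right) auto
  moreover have "(P ** R) $ i $ k = 0"
    using \<open>i \<noteq> k\<close> by (simp add: inv mat_def)
  ultimately show ?thesis
    using nz by (simp add: matrix_matrix_mult_def)
qed

lemma unit_preserving_term_zero:
  fixes P Q :: "complex^'n^'n"
  assumes unit: "tensor_prod m P (unit_tensor m) Q = unit_tensor m" and "m \<ge> 3"
    and "length ix = m" and nd: "ix \<noteq> replicate m (ix ! 0)"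
  shows "P $ (ix ! 0) $ j * (\<Prod>k=1..<m. Q $ j $ (ix ! k)) = 0"
proof (rule ccontr)
  assume nz: "\<not> ?thesis"
  then have q: "Q $ j $ (ix ! k) \<noteq> 0" if "1 \<le> k" "k < m" for k
    using that by auto
  have tail: "ix ! k = ix ! 1" if "1 \<le> k" "k < m" for k
    using unit_preserving_row_support[OF unit \<open>m \<ge> 3\<close>, of "ix ! k" "ix ! 1" j]
      q[of k] q[of 1] that by auto
  have head: "ix ! 0 = ix ! 1"
  proof (rule ccontr)
    assume "ix ! 0 \<noteq> ix ! 1"
    then have "P $ (ix ! 0) $ j = 0"
      using unit_preserving_right_inverse[OF unit] unit_preserving_row_support[OF unit \<open>m \<ge> 3\<close>]
        q[of 1] \<open>m \<ge> 3\<close>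
      by (intro inverse_of_row_sparse[where R = "\<chi> j k. (Q $ j $ k) ^ (m - 1)" and k = "ix ! 1"]) auto
    then show False
      using nz by simp
  qed
  have "ix ! k = replicate m (ix ! 0) ! k" if "k < m" for k
    using tail[of k] head that by (cases "k = 0") auto
  moreover have "length ix = length (replicate m (ix ! 0))"
    using \<open>length ix = m\<close> by simp
  ultimately have "ix = replicate m (ix ! 0)"
    using \<open>length ix = m\<close> nth_equalityI by metis
  with nd show False
    by contradiction
qed

theorem corollary3p6:
  fixes m :: nat and A B :: "'n::finite list \<Rightarrow> complex"
  assumes "m \<ge> 3"
    and "A \<in> tensors m"
    and "B \<in> tensors m"
    and "similar_tensors m A B"
    and "diagonal_tensor m A"
  shows "diagonal_tensor m B"
proof -
  obtain P Q :: "complex^'n^'n" where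
    unit: "tensor_prod m P (unit_tensor m) Q = unit_tensor m" and B: "B = tensor_prod m P A Q"
    using assms(4) unfolding similar_tensors_def by blast
  show ?thesis
    unfolding diagonal_tensor_def
  proof (intro ballI impI)
    fix ix :: "'n list"
    assume "ix \<in> multi_indices m" and nd: "ix \<noteq> replicate m (ix ! 0)"
    then have len: "length ix = m"
      by (simp add: multi_indices_def)
    have "B ix = (\<Sum>j\<in>UNIV. P $ (ix ! 0) $ j * A (replicate m j) * (\<Prod>k=1..<m. Q $ j $ (ix ! k)))"
      using B tensor_prod_diagonal[OF _ assms(5) len] assms(1) by simp
    also have "\<dots> = 0"
      using unit_preserving_term_zero[OF unit assms(1) len nd] by (intro sum.neutral) auto
    finally show "B ix = 0" .
  qed
qed

end
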